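(* Let $A$ be an $m \times n$ matrix with complex entries. If $A$ is a $(q,k,t)$-design matrix, then $$\operatorname{rank}(A) \;\geq\; \frac{n}{1 + \frac{q(q-1)t}{k}} \;\geq\; n - \frac{ntq(q-1)}{k}.$$
   Context: For a vector $v \in \mathbb{C}^N$, $\operatorname{supp}(v) = \{i : v_i \neq 0\}$. Let $A$ be an $m\times n$ matrix over $\mathbb{C}$ with rows $R_1,\dots,R_m \in \mathbb{C}^n$ and columns $C_1,\dots,C_n \in \mathbb{C}^m$. $A$ is a $(q,k,t)$-design matrix (with $q,k$ positive integers and $t$ a nonnegative integer) if: (1) $|\operatorname{supp}(R_i)| \le q$ for all $i \in [m]$; (2) $|\operatorname{supp}(C_j)| \ge k$ for all $j \in [n]$; (3) $|\operatorname{supp}(C_{j_1}) \cap \operatorname{supp}(C_{j_2})| \le t$ for all $j_1 \ne j_2 \in [n]$. *)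

theory Defs
  imports Complex_Main "Jordan_Normal_Form.DL_Rank"
begin

definition supp_vec :: "complex vec \<Rightarrow> nat set" where
  "supp_vec v = {i. i < dim_vec v \<and> v $ i \<noteq> 0}"

(* Rows and columns are indexed from 0, as usual for this matrix type. *)
definition design_matrix :: "nat \<Rightarrow> nat \<Rightarrow> nat \<Rightarrow> complex mat \<Rightarrow> bool" where
  "design_matrix q k t A \<longleftrightarrow>
     (\<forall>i < dim_row A. card (supp_vec (row A i)) \<le> q) \<and>
     (\<forall>j < dim_col A. card (supp_vec (col A j)) \<ge> k) \<and>
     (\<forall>j1 < dim_col A. \<forall>j2 < dim_col A. j1 \<noteq> j2 \<longrightarrow>
        card (supp_vec (col A j1) \<inter> supp_vec (col A j2)) \<le> t)"

end

theory Submission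
  imports Defs "HOL-Analysis.Convex"
begin

text \<open>
  Rescaling rows and columns of \<open>A\<close> does not increase the rank. Scale so that the squared moduli
  \<open>x i j\<close> of the entries have all column sums equal to 1 and all row sums at most some \<open>\<gamma> > q / k\<close>. The Gram
  matrix \<open>G\<close> of the columns then has unit diagonal, and by Cauchy--Schwarz on the common supports its
  off-diagonal entries satisfy \<open>|G j j'|\<^sup>2 \<le> t * (\<Sum>i. x i j * x i j')\<close>, which sum to at most
  \<open>t * (1 - 1 / q) * \<gamma> * n\<close>. Conclude with \<open>(tr G)\<^sup>2 \<le> rank G * (Frobenius norm of G)\<^sup>2\<close>.
\<close>

section \<open>Rank factorisation as a finite sum\<close>

text \<open>A maximal independent set of columns has \<open>rank A\<close> elements, and maximality
  puts every column in its span. The sum form lets later arguments absorb row and column factors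
  into the two sides without changing the number of terms.\<close>

lemma (in vec_space) rank_factorization:
  assumes A: "A \<in> carrier_mat n nc"
  obtains S c where "finite S" "card S = rank A"
    "\<And>i j. i < n \<Longrightarrow> j < nc \<Longrightarrow> A $$ (i, j) = (\<Sum>v\<in>S. c j v * v $ i)"
proof -
  obtain S where S: "maximal S (\<lambda>T. T \<subseteq> set (cols A) \<and> lin_indpt T)" "finite S"
    using maximal_exists_superset[of "set (cols A)" "\<lambda>T. T \<subseteq> set (cols A) \<and> lin_indpt T" "{}"]
    by (auto simp: finite_lin_indpt2)
  have sub: "S \<subseteq> set (cols A)" and li: "lin_indpt S"
    and mx: "\<And>T. S \<subseteq> T \<Longrightarrow> T \<subseteq> set (cols A) \<Longrightarrow> lin_indpt T \<Longrightarrow> T = S"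
    using S(1) unfolding maximal_def by auto
  have carr: "set (cols A) \<subseteq> carrier_vec n"
    using A cols_dim by blast
  have Sc: "S \<subseteq> carrier_vec n" using sub carr by blast
  have "\<exists>a. col A j = lincomb a S" if j: "j < nc" for j
  proof -
    have cA: "col A j \<in> set (cols A)"
      using A j by (auto simp: cols_def)
    then have cc: "col A j \<in> carrier_vec n" using carr by blast
    have "col A j \<in> span S"
    proof (cases "col A j \<in> S")
      case True
      then show ?thesis using Sc span_mem by blast
    next
      case False
      show ?thesis
      proof (rule ccontr)
        assume "col A j \<notin> span S"
        then have "lin_indpt (insert (col A j) S)"
          using lin_dep_iff_in_span[OF _ li _ False] Sc cc by auto
        then have "insert (col A j) S = S"
          using mx cA sub by blast
        with False show False by blast
      qed
    qed
    then obtain a where "lincomb a S = col A j"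
      using finite_in_span[OF S(2), of "col A j"] Sc by auto
    then show ?thesis by metis
  qed
  then obtain c where c: "\<And>j. j < nc \<Longrightarrow> col A j = lincomb (c j) S" by metis
  show thesis
  proof (rule that[of S c])
    show "finite S" by fact
    show "card S = rank A" using rank_card_indpt[OF A S(1)] by simp
    show "A $$ (i, j) = (\<Sum>v\<in>S. c j v * v $ i)" if "i < n" "j < nc" for i j
    proof -
      have "A $$ (i, j) = col A j $ i" using A that by auto
      then show ?thesis using c[OF that(2)] lincomb_index[OF that(1) Sc] by simp
    qed
  qed
qed

section \<open>Orthonormal coordinates and the trace inequality for Gram matrices\<close>

text \<open>Gram--Schmidt by induction on \<open>S\<close>, with vectors as functions on
  \<open>I\<close>. The orthonormal family is indexed by a subset of \<open>S\<close>, so its size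
  is at most \<open>card S\<close>; a vector whose residual vanishes adds no index.\<close>

lemma orthonormal_spanning_family:
  fixes p :: "'v \<Rightarrow> 'i \<Rightarrow> complex"
  assumes "finite S" "finite I"
  shows "\<exists>T e c. T \<subseteq> S \<and>
    (\<forall>u\<in>T. \<forall>v\<in>T. (\<Sum>i\<in>I. e u i * cnj (e v i)) = (if u = v then 1 else 0)) \<and>
    (\<forall>v\<in>S. \<forall>i\<in>I. p v i = (\<Sum>u\<in>T. c v u * e u i))"
  using assms(1)
proof (induction S)
  case empty
  show ?case by (rule exI[of _ "{}"]) simp
next
  case (insert x S)
  then obtain T e c where T: "T \<subseteq> S"
    and orth: "\<And>u v. u \<in> T \<Longrightarrow> v \<in> T \<Longrightarrow> (\<Sum>i\<in>I. e u i * cnj (e v i)) = (if u = v then 1 else 0)"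
    and comb: "\<And>v i. v \<in> S \<Longrightarrow> i \<in> I \<Longrightarrow> p v i = (\<Sum>u\<in>T. c v u * e u i)"
    by blast
  have finT: "finite T" using T insert.hyps finite_subset by blast
  have xT: "x \<notin> T" using T insert.hyps by blast
  \<comment> \<open>\<open>d\<close> holds the Fourier coefficients of the new vector
    \<open>p x\<close> along the family so far, \<open>w\<close> is the residual, and
    \<open>N\<close> its squared norm.\<close>
  define d where "d u = (\<Sum>i\<in>I. p x i * cnj (e u i))" for u
  define w where "w i = p x i - (\<Sum>u\<in>T. d u * e u i)" for i
  define N where "N = (\<Sum>i\<in>I. (cmod (w i))\<^sup>2)"
  show ?case
  proof (cases "N = 0")
    case True
    then have w0: "w i = 0" if "i \<in> I" for i
      using that assms(2) by (simp add: N_def sum_nonneg_eq_0_iff)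
    have "p v i = (\<Sum>u\<in>T. (c(x := d)) v u * e u i)" if "v \<in> insert x S" "i \<in> I" for v i
      using that w0[of i] comb[of v i] insert.hyps by (auto simp: w_def)
    then show ?thesis
      using T orth by (intro exI[of _ T] exI[of _ e] exI[of _ "c(x := d)"]) auto
  next
    case False
    have N: "N > 0" using False by (simp add: N_def less_le sum_nonneg)
    define s where "s = complex_of_real (sqrt N)"
    have s: "s \<noteq> 0" "cnj s = s" "s * s = of_real N"
      using N unfolding s_def by (simp_all flip: of_real_mult)
    \<comment> \<open>The label \<open>x\<close> is given to the normalised residual. In
      \<open>c'\<close>, the coefficient \<open>s\<close> at \<open>x\<close> undoes the
      normalisation for \<open>p x\<close>, and old vectors get 0 there.\<close>
    define e' where "e' = e(x := (\<lambda>i. w i / s))"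
    define c' where "c' v u = (if v = x then if u = x then s else d u else if u = x then 0 else c v u)" for v u
    have wN: "(\<Sum>i\<in>I. w i * cnj (w i)) = of_real N"
      unfolding N_def of_real_sum complex_norm_square ..
    have wT: "(\<Sum>i\<in>I. w i * cnj (e v i)) = 0" if v: "v \<in> T" for v
    proof -
      have "(\<Sum>i\<in>I. w i * cnj (e v i)) = d v - (\<Sum>i\<in>I. \<Sum>u\<in>T. d u * (e u i * cnj (e v i)))"
        by (simp add: w_def d_def algebra_simps sum_subtractf sum_distrib_right sum_distrib_left)
      also have "(\<Sum>i\<in>I. \<Sum>u\<in>T. d u * (e u i * cnj (e v i))) = (\<Sum>u\<in>T. d u * (\<Sum>i\<in>I. e u i * cnj (e v i)))"
        by (subst sum.swap) (simp add: sum_distrib_left)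
      also have "\<dots> = (\<Sum>u\<in>T. if u = v then d u else 0)"
        by (intro sum.cong refl) (simp add: orth v)
      also have "\<dots> = d v" using v finT by simp
      finally show ?thesis by simp
    qed
    have Tw: "(\<Sum>i\<in>I. e v i * cnj (w i)) = 0" if "v \<in> T" for v
    proof -
      have "cnj (\<Sum>i\<in>I. w i * cnj (e v i)) = 0" using wT[OF that] by simp
      then show ?thesis by (simp add: mult.commute)
    qed
    have "(\<Sum>i\<in>I. e' u i * cnj (e' v i)) = (if u = v then 1 else 0)"
      if "u \<in> insert x T" "v \<in> insert x T" for u v
    proof -
      consider "u = x" "v = x" | "u = x" "v \<in> T" "v \<noteq> x" | "u \<in> T" "v = x" "u \<noteq> x"
        | "u \<in> T" "v \<in> T" "u \<noteq> x" "v \<noteq> x"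
        using \<open>u \<in> insert x T\<close> \<open>v \<in> insert x T\<close> xT by blast
      then show ?thesis
      proof cases
        case 1
        have "(\<Sum>i\<in>I. e' x i * cnj (e' x i)) = (\<Sum>i\<in>I. w i * cnj (w i)) / (s * s)"
          by (simp add: e'_def s sum_divide_distrib)
        then show ?thesis using 1 wN s N by simp
      next
        case 2
        then show ?thesis using wT[of v] by (simp add: e'_def flip: sum_divide_distrib)
      next
        case 3
        then show ?thesis using Tw[of u] by (simp add: e'_def flip: sum_divide_distrib)
      next
        case 4
        then show ?thesis using orth by (simp add: e'_def)
      qed
    qed
    moreover have "p v i = (\<Sum>u\<in>insert x T. c' v u * e' u i)" if "v \<in> insert x S" "i \<in> I" for v i
    proof -
      have "(\<Sum>u\<in>insert x T. c' v u * e' u i) = c' v x * (w i / s) + (\<Sum>u\<in>T. c' v u * e u i)"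
        using finT xT by (auto simp: e'_def intro!: sum.cong)
      also have "\<dots> = p v i"
      proof (cases "v = x")
        case True
        have "(\<Sum>u\<in>T. c' x u * e u i) = (\<Sum>u\<in>T. d u * e u i)"
          using xT by (intro sum.cong) (auto simp: c'_def)
        then show ?thesis using True s by (simp add: c'_def w_def)
      next
        case False
        have "(\<Sum>u\<in>T. c' v u * e u i) = (\<Sum>u\<in>T. c v u * e u i)"
          using xT False by (intro sum.cong) (auto simp: c'_def)
        then show ?thesis using False comb that by (simp add: c'_def)
      qed
      finally show ?thesis by simp
    qed
    ultimately show ?thesis
      using T by (intro exI[of _ "insert x T"] exI[of _ e'] exI[of _ c']) blast
  qed
qed

text \<open>For the matrix \<open>c\<close>, this says that \<open>c c*\<close> and
  \<open>c* c\<close> have the same Frobenius norm, up to conjugating entries. Both sides expand to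
  the same sum of fourfold products over \<open>j\<close>, \<open>j'\<close>, \<open>u\<close>,
  \<open>v\<close>.\<close>

lemma frobenius_norm_gram_swap:
  fixes c :: "'j \<Rightarrow> 'v \<Rightarrow> complex"
  shows "(\<Sum>j\<in>J. \<Sum>j'\<in>J. (cmod (\<Sum>u\<in>T. c j u * cnj (c j' u)))\<^sup>2) =
         (\<Sum>u\<in>T. \<Sum>v\<in>T. (cmod (\<Sum>j\<in>J. c j u * cnj (c j v)))\<^sup>2)"
proof -
  have "complex_of_real (\<Sum>j\<in>J. \<Sum>j'\<in>J. (cmod (\<Sum>u\<in>T. c j u * cnj (c j' u)))\<^sup>2) =
    (\<Sum>j\<in>J. \<Sum>j'\<in>J. \<Sum>u\<in>T. \<Sum>v\<in>T. (c j u * cnj (c j' u)) * (cnj (c j v) * c j' v))"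
    unfolding of_real_sum complex_norm_square by (simp add: sum_product)
  also have "\<dots> = (\<Sum>(j,j')\<in>J\<times>J. \<Sum>(u,v)\<in>T\<times>T. (c j u * cnj (c j' u)) * (cnj (c j v) * c j' v))"
    unfolding sum.cartesian_product[symmetric] ..
  also have "\<dots> = (\<Sum>(u,v)\<in>T\<times>T. \<Sum>(j,j')\<in>J\<times>J. (c j u * cnj (c j v)) * (cnj (c j' u) * c j' v))"
    unfolding case_prod_beta by (subst sum.swap) (simp add: mult_ac)
  also have "\<dots> = (\<Sum>u\<in>T. \<Sum>v\<in>T. \<Sum>j\<in>J. \<Sum>j'\<in>J. (c j u * cnj (c j v)) * (cnj (c j' u) * c j' v))"
    unfolding sum.cartesian_product[symmetric] ..
  also have "\<dots> = complex_of_real (\<Sum>u\<in>T. \<Sum>v\<in>T. (cmod (\<Sum>j\<in>J. c j u * cnj (c j v)))\<^sup>2)"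
    unfolding of_real_sum complex_norm_square by (simp add: sum_product)
  finally show ?thesis using of_real_eq_iff by blast
qed

text \<open>The inequality between trace, rank and Frobenius norm, without eigenvalues. In
  orthonormal coordinates the Gram matrix of the \<open>b j\<close> can be exchanged for one indexed
  by \<open>T\<close>, with the same trace and Frobenius norm; its trace has at most
  \<open>card S\<close> terms, so Cauchy--Schwarz on its diagonal suffices.\<close>

lemma gram_trace_le:
  fixes b :: "'j \<Rightarrow> 'i \<Rightarrow> complex" and p :: "'v \<Rightarrow> 'i \<Rightarrow> complex"
  assumes "finite S" "finite I" "finite J"
    and b: "\<And>j i. j \<in> J \<Longrightarrow> i \<in> I \<Longrightarrow> b j i = (\<Sum>v\<in>S. a j v * p v i)"
  shows "(\<Sum>j\<in>J. \<Sum>i\<in>I. (cmod (b j i))\<^sup>2)\<^sup>2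
    \<le> real (card S) * (\<Sum>j\<in>J. \<Sum>j'\<in>J. (cmod (\<Sum>i\<in>I. b j i * cnj (b j' i)))\<^sup>2)"
proof -
  obtain T e c where T: "T \<subseteq> S"
    and orth: "\<And>u v. u \<in> T \<Longrightarrow> v \<in> T \<Longrightarrow> (\<Sum>i\<in>I. e u i * cnj (e v i)) = (if u = v then 1 else 0)"
    and comb: "\<And>v i. v \<in> S \<Longrightarrow> i \<in> I \<Longrightarrow> p v i = (\<Sum>u\<in>T. c v u * e u i)"
    using orthonormal_spanning_family[OF assms(1,2), of p] by blast
  have finT: "finite T" using T assms(1) finite_subset by blast
  \<comment> \<open>Coordinates of \<open>b j\<close> in the orthonormal family
    \<open>e\<close>.\<close>
  define g where "g j u = (\<Sum>v\<in>S. a j v * c v u)" for j u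
  have bg: "b j i = (\<Sum>u\<in>T. g j u * e u i)" if "j \<in> J" "i \<in> I" for j i
  proof -
    have "b j i = (\<Sum>v\<in>S. \<Sum>u\<in>T. a j v * c v u * e u i)"
      using b[OF that] comb that by (simp add: sum_distrib_left mult.assoc)
    also have "\<dots> = (\<Sum>u\<in>T. \<Sum>v\<in>S. a j v * c v u * e u i)" by (rule sum.swap)
    finally show ?thesis by (simp add: g_def sum_distrib_right)
  qed
  have gram: "(\<Sum>i\<in>I. b j i * cnj (b j' i)) = (\<Sum>u\<in>T. g j u * cnj (g j' u))"
    if "j \<in> J" "j' \<in> J" for j j'
  proof -
    have "(\<Sum>i\<in>I. b j i * cnj (b j' i)) =
        (\<Sum>i\<in>I. \<Sum>u\<in>T. \<Sum>v\<in>T. (g j u * cnj (g j' v)) * (e u i * cnj (e v i)))"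
      using bg that by (simp add: sum_product mult_ac)
    also have "\<dots> = (\<Sum>u\<in>T. \<Sum>i\<in>I. \<Sum>v\<in>T. (g j u * cnj (g j' v)) * (e u i * cnj (e v i)))"
      by (rule sum.swap)
    also have "\<dots> = (\<Sum>u\<in>T. \<Sum>v\<in>T. \<Sum>i\<in>I. (g j u * cnj (g j' v)) * (e u i * cnj (e v i)))"
      by (rule sum.cong[OF refl], rule sum.swap)
    also have "\<dots> = (\<Sum>u\<in>T. \<Sum>v\<in>T. (g j u * cnj (g j' v)) * (\<Sum>i\<in>I. e u i * cnj (e v i)))"
      by (simp add: sum_distrib_left)
    also have "\<dots> = (\<Sum>u\<in>T. \<Sum>v\<in>T. if u = v then g j u * cnj (g j' v) else 0)"
      by (intro sum.cong refl) (simp add: orth)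
    also have "\<dots> = (\<Sum>u\<in>T. g j u * cnj (g j' u))"
      using finT by simp
    finally show ?thesis .
  qed
  \<comment> \<open>The diagonal of the Gram matrix indexed by \<open>T\<close>; its sum is the
    trace.\<close>
  define h where "h u = (\<Sum>j\<in>J. (cmod (g j u))\<^sup>2)" for u
  have diag: "(\<Sum>i\<in>I. (cmod (b j i))\<^sup>2) = (\<Sum>u\<in>T. (cmod (g j u))\<^sup>2)" if "j \<in> J" for j
  proof -
    have "complex_of_real (\<Sum>i\<in>I. (cmod (b j i))\<^sup>2) = complex_of_real (\<Sum>u\<in>T. (cmod (g j u))\<^sup>2)"
      unfolding of_real_sum complex_norm_square using gram[OF that that] by simp
    then show ?thesis using of_real_eq_iff by blast
  qed
  have h: "(h u)\<^sup>2 = (cmod (\<Sum>j\<in>J. g j u * cnj (g j u)))\<^sup>2" for u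
  proof -
    have "(\<Sum>j\<in>J. g j u * cnj (g j u)) = of_real (h u)"
      unfolding h_def of_real_sum complex_norm_square ..
    then show ?thesis by simp
  qed
  have "(\<Sum>j\<in>J. \<Sum>i\<in>I. (cmod (b j i))\<^sup>2) = (\<Sum>j\<in>J. \<Sum>u\<in>T. (cmod (g j u))\<^sup>2)"
    using diag by (rule sum.cong[OF refl])
  also have "\<dots> = (\<Sum>u\<in>T. h u)"
    unfolding h_def by (rule sum.swap)
  finally have "(\<Sum>j\<in>J. \<Sum>i\<in>I. (cmod (b j i))\<^sup>2)\<^sup>2 = (\<Sum>u\<in>T. h u)\<^sup>2" by simp
  also have "\<dots> \<le> (\<Sum>u\<in>T. (h u)\<^sup>2) * card T"
    by (rule sum_squared_le_sum_of_squares)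
  \<comment> \<open>The squared diagonal entry \<open>h u\<close> is one of the nonnegative terms of
    the sum over \<open>v\<close>.\<close>
  also have "\<dots> \<le> (\<Sum>u\<in>T. \<Sum>v\<in>T. (cmod (\<Sum>j\<in>J. g j u * cnj (g j v)))\<^sup>2) * card S"
  proof (intro mult_mono sum_mono)
    show "(h u)\<^sup>2 \<le> (\<Sum>v\<in>T. (cmod (\<Sum>j\<in>J. g j u * cnj (g j v)))\<^sup>2)" if "u \<in> T" for u
      unfolding h using that finT
      by (intro member_le_sum[where f = "\<lambda>v. (cmod (\<Sum>j\<in>J. g j u * cnj (g j v)))\<^sup>2"]) auto
    show "real (card T) \<le> real (card S)" using card_mono[OF assms(1) T] by simp
  qed (auto intro!: sum_nonneg)
  also have "(\<Sum>u\<in>T. \<Sum>v\<in>T. (cmod (\<Sum>j\<in>J. g j u * cnj (g j v)))\<^sup>2)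
      = (\<Sum>j\<in>J. \<Sum>j'\<in>J. (cmod (\<Sum>i\<in>I. b j i * cnj (b j' i)))\<^sup>2)"
    using frobenius_norm_gram_swap[where c = g and J = J and T = T] by (simp add: gram)
  finally show ?thesis by (simp add: mult.commute)
qed

section \<open>Approximate matrix scaling\<close>

text \<open>
  With column factors normalising the column sums, the row factors \<open>w\<close> come from almost minimising
  \<open>\<Sum>j. ln (D w j) - \<beta> * (\<Sum>i. ln (w i))\<close> over \<open>0 < w i \<le> 1\<close>; the fractional scaling \<open>y\<close> bounds it
  from below. If row \<open>i\<close> had sum above \<open>\<gamma>\<close>, shrinking \<open>w i\<close> by a fixed factor \<open>c\<close> would lower the value by
  a fixed amount \<open>\<delta>\<close>. The gap \<open>\<beta> < \<gamma>\<close> makes it unnecessary that the infimum is attained.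
\<close>

lemma matrix_scaling:
  fixes a y :: "'i \<Rightarrow> 'j \<Rightarrow> real"
  assumes fin: "finite I" "finite J"
    and a: "\<And>i j. i \<in> I \<Longrightarrow> j \<in> J \<Longrightarrow> a i j \<ge> 0"
    and y: "\<And>i j. i \<in> I \<Longrightarrow> j \<in> J \<Longrightarrow> y i j \<ge> 0"
    and supp: "\<And>i j. i \<in> I \<Longrightarrow> j \<in> J \<Longrightarrow> y i j > 0 \<Longrightarrow> a i j > 0"
    and col: "\<And>j. j \<in> J \<Longrightarrow> (\<Sum>i\<in>I. y i j) = 1"
    and row: "\<And>i. i \<in> I \<Longrightarrow> (\<Sum>j\<in>J. y i j) \<le> \<beta>"
    and \<beta>: "0 < \<beta>" "\<beta> < \<gamma>"
  obtains w where "\<And>i. i \<in> I \<Longrightarrow> w i > 0"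
    "\<And>j. j \<in> J \<Longrightarrow> (\<Sum>i\<in>I. w i * a i j) > 0"
    "\<And>i. i \<in> I \<Longrightarrow> (\<Sum>j\<in>J. w i * a i j / (\<Sum>i\<in>I. w i * a i j)) \<le> \<gamma>"
proof -
  define D where "D w j = (\<Sum>i\<in>I. w i * a i j)" for w j
  define \<Phi> where "\<Phi> w = (\<Sum>j\<in>J. ln (D w j)) - \<beta> * (\<Sum>i\<in>I. ln (w i))" for w
  define W where "W = {w. \<forall>i\<in>I. 0 < w i \<and> w i \<le> (1::real)}"
  have Dge: "w i * a i j \<le> D w j" if "w \<in> W" "i \<in> I" "j \<in> J" for w i j
    unfolding D_def using that a fin
    by (intro member_le_sum[where f = "\<lambda>i. w i * a i j"]) (auto simp: W_def intro: mult_nonneg_nonneg less_imp_le)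
  have Dpos: "D w j > 0" if "w \<in> W" "j \<in> J" for w j
  proof -
    obtain i where i: "i \<in> I" "y i j \<noteq> 0"
      using col[OF \<open>j \<in> J\<close>] by (metis sum.neutral zero_neq_one)
    then have "a i j > 0" using y supp \<open>j \<in> J\<close> by (simp add: less_le)
    then have "0 < w i * a i j" using i that by (auto simp: W_def)
    also have "\<dots> \<le> D w j" using Dge that i by blast
    finally show ?thesis .
  qed
  define K where "K = (\<Sum>j\<in>J. \<Sum>i\<in>I. y i j * ln (a i j))"
  \<comment> \<open>Each column of \<open>y\<close> is a probability vector and
    \<open>w i * a i j\<close> is at most \<open>D w j\<close>, so averaging logarithms bounds
    \<open>ln (D w j)\<close> from below. After summing over \<open>j\<close>, the sign of
    \<open>ln (w i)\<close>, ensured by the cap 1 in \<open>W\<close>, lets \<beta> replace the row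
    sums of \<open>y\<close>.\<close>
  have bound: "K \<le> \<Phi> w" if w: "w \<in> W" for w
  proof -
    have wp: "0 < w i" "ln (w i) \<le> 0" if "i \<in> I" for i
      using w that by (auto simp: W_def)
    have "(\<Sum>i\<in>I. y i j * (ln (w i) + ln (a i j))) \<le> ln (D w j)" if j: "j \<in> J" for j
    proof -
      have "(\<Sum>i\<in>I. y i j * (ln (w i) + ln (a i j))) \<le> (\<Sum>i\<in>I. y i j * ln (D w j))"
      proof (rule sum_mono)
        fix i assume i: "i \<in> I"
        show "y i j * (ln (w i) + ln (a i j)) \<le> y i j * ln (D w j)"
        \<comment> \<open>If \<open>a i j = 0\<close> then \<open>y i j = 0\<close>, so the value of
          \<open>ln\<close> at 0 does not matter.\<close>
        proof (cases "y i j = 0")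
          case False
          then have ap: "a i j > 0" using supp y i j by (simp add: less_le)
          have "ln (w i) + ln (a i j) = ln (w i * a i j)"
            using ap wp[OF i] by (simp add: ln_mult)
          also have "\<dots> \<le> ln (D w j)"
            using Dge[OF w i j] ap wp[OF i] Dpos[OF w j] by simp
          finally show ?thesis using y[OF i j] by (rule mult_left_mono)
        qed simp
      qed
      also have "\<dots> = ln (D w j)" using col[OF j] by (simp flip: sum_distrib_right)
      finally show ?thesis .
    qed
    then have "(\<Sum>j\<in>J. \<Sum>i\<in>I. y i j * (ln (w i) + ln (a i j))) \<le> (\<Sum>j\<in>J. ln (D w j))"
      by (rule sum_mono)
    moreover have "(\<Sum>j\<in>J. \<Sum>i\<in>I. y i j * (ln (w i) + ln (a i j)))
        = (\<Sum>i\<in>I. ln (w i) * (\<Sum>j\<in>J. y i j)) + K"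
      unfolding K_def
      by (simp add: distrib_left sum.distrib sum_distrib_left mult.commute) (rule sum.swap)
    moreover have "(\<Sum>i\<in>I. ln (w i) * (\<Sum>j\<in>J. y i j)) \<ge> (\<Sum>i\<in>I. ln (w i) * \<beta>)"
      using row wp by (intro sum_mono mult_left_mono_neg) auto
    ultimately show ?thesis
      by (simp add: \<Phi>_def sum_distrib_left mult.commute)
  qed
  have bdd: "bdd_below (\<Phi> ` W)" using bound by (auto intro!: bdd_belowI)
  obtain c where c: "\<beta> / \<gamma> < c" "c < 1"
    using dense[of "\<beta> / \<gamma>" 1] \<beta> by auto
  have c0: "c > 0" using c \<beta> by (meson divide_pos_pos less_trans)
  \<comment> \<open>Shrinking \<open>w i\<close> lowers the sum of \<open>ln (D w j)\<close> by at
    least \<open>(1 - c) * \<gamma>\<close> and raises the \<beta> term by at most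
    \<open>\<beta> * (1 - c) / c\<close>. The difference is \<delta>, positive because
    \<open>c\<close> exceeds \<open>\<beta> / \<gamma>\<close>.\<close>
  define \<delta> where "\<delta> = (1 - c) * (\<gamma> - \<beta> / c)"
  have "\<beta> / c < \<gamma>" using c(1) c0 \<beta> by (simp add: field_simps)
  then have \<delta>: "\<delta> > 0" using c(2) by (simp add: \<delta>_def)
  have "(\<lambda>_. 1) \<in> W" by (simp add: W_def)
  then have "\<exists>v\<in>\<Phi> ` W. v < Inf (\<Phi> ` W) + \<delta>"
    using \<delta> bdd by (subst cInf_less_iff[symmetric]) auto
  then obtain w where w: "w \<in> W" "\<Phi> w < Inf (\<Phi> ` W) + \<delta>" by blast
  have "(\<Sum>j\<in>J. w i * a i j / D w j) \<le> \<gamma>" if i: "i \<in> I" for i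
  proof (rule ccontr)
    assume r: "\<not> ?thesis"
    define w' where "w' = w(i := c * w i)"
    have wi: "w i > 0" using w i by (simp add: W_def)
    have w': "w' \<in> W" using w(1) c c0
      by (auto simp: W_def w'_def mult_le_one)
    have D': "D w' j = D w j - (1 - c) * (w i * a i j)" for j
      unfolding D_def w'_def using i fin
      by (simp add: sum.remove algebra_simps)
    \<comment> \<open>The bound \<open>ln s <= s - 1\<close> at the ratio of new to old column sum
      makes the decrease linear, so that summing over \<open>j\<close> produces the row sum.\<close>
    have lnD: "ln (D w' j) \<le> ln (D w j) - (1 - c) * (w i * a i j / D w j)" if j: "j \<in> J" for j
    proof -
      have "ln (D w' j) - ln (D w j) = ln (D w' j / D w j)"
        using Dpos[OF w(1) j] Dpos[OF w' j] by (simp add: ln_div)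
      also have "\<dots> \<le> D w' j / D w j - 1"
        using Dpos[OF w(1) j] Dpos[OF w' j] by (intro ln_le_minus_one) simp
      also have "\<dots> = - (1 - c) * (w i * a i j / D w j)"
        using Dpos[OF w(1) j] by (simp add: D' field_simps)
      finally show ?thesis by (simp add: algebra_simps diff_divide_distrib)
    qed
    have lnc: "- ln c \<le> (1 - c) / c"
      using ln_le_minus_one[of "1 / c"] c0 by (simp add: ln_div field_simps)
    have "(\<Sum>j\<in>J. ln (D w' j)) \<le> (\<Sum>j\<in>J. ln (D w j) - (1 - c) * (w i * a i j / D w j))"
      using lnD by (rule sum_mono)
    also have "\<dots> = (\<Sum>j\<in>J. ln (D w j)) - (1 - c) * (\<Sum>j\<in>J. w i * a i j / D w j)"
      by (simp add: sum_subtractf sum_distrib_left)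
    also have "\<dots> \<le> (\<Sum>j\<in>J. ln (D w j)) - (1 - c) * \<gamma>"
      using r c by (intro diff_left_mono mult_left_mono) auto
    finally have 1: "(\<Sum>j\<in>J. ln (D w' j)) \<le> (\<Sum>j\<in>J. ln (D w j)) - (1 - c) * \<gamma>" .
    have 2: "(\<Sum>i\<in>I. ln (w' i)) = (\<Sum>i\<in>I. ln (w i)) + ln c"
      unfolding w'_def using i fin wi c0 by (simp add: sum.remove ln_mult)
    have "\<beta> * (- ln c) \<le> \<beta> * ((1 - c) / c)"
      using lnc \<beta> by (intro mult_left_mono) auto
    then have "\<Phi> w' \<le> \<Phi> w - \<delta>"
      using 1 unfolding \<Phi>_def 2 \<delta>_def by (simp add: algebra_simps)
    moreover have "Inf (\<Phi> ` W) \<le> \<Phi> w'" using bdd w' by (intro cInf_lower) auto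
    ultimately show False using w(2) by simp
  qed
  then show thesis
    using w(1) Dpos[OF w(1)] by (intro that[of w]) (auto simp: D_def W_def)
qed

section \<open>Cauchy--Schwarz bounds from sparsity\<close>

text \<open>At most \<open>t\<close> terms of the inner product are nonzero, so Cauchy--Schwarz
  costs a factor \<open>t\<close>. What remains are products of squared moduli, which row sums can
  control.\<close>

lemma norm_inner_sq_le_overlap:
  fixes b b' :: "'i \<Rightarrow> complex"
  assumes "finite I" "card {i\<in>I. b i \<noteq> 0 \<and> b' i \<noteq> 0} \<le> t"
  shows "(cmod (\<Sum>i\<in>I. b i * cnj (b' i)))\<^sup>2 \<le> real t * (\<Sum>i\<in>I. (cmod (b i))\<^sup>2 * (cmod (b' i))\<^sup>2)"
proof -
  define K where "K = {i\<in>I. b i \<noteq> 0 \<and> b' i \<noteq> 0}"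
  have K: "K \<subseteq> I" "finite K" using assms(1) by (auto simp: K_def)
  have "(\<Sum>i\<in>I. b i * cnj (b' i)) = (\<Sum>i\<in>K. b i * cnj (b' i))"
    using assms(1) by (intro sum.mono_neutral_right) (auto simp: K_def)
  then have "(cmod (\<Sum>i\<in>I. b i * cnj (b' i)))\<^sup>2 \<le> (\<Sum>i\<in>K. cmod (b i * cnj (b' i)))\<^sup>2"
    by (intro power_mono) (auto intro: norm_sum)
  also have "\<dots> \<le> (\<Sum>i\<in>K. (cmod (b i * cnj (b' i)))\<^sup>2) * card K"
    by (rule sum_squared_le_sum_of_squares)
  also have "\<dots> \<le> (\<Sum>i\<in>I. (cmod (b i * cnj (b' i)))\<^sup>2) * real t"
    using K assms by (intro mult_mono sum_mono2 sum_nonneg) (auto simp: K_def)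
  finally show ?thesis by (simp add: norm_mult power_mult_distrib mult.commute)
qed

text \<open>The off-diagonal part is the square of the sum minus the sum of squares, and
  Cauchy--Schwarz on at most \<open>q\<close> nonzero terms makes the latter at least a
  \<open>1 / q\<close> share. This is the source of the factor \<open>q - 1\<close> in the rank
  bound.\<close>

lemma sum_off_diagonal_le:
  fixes x :: "'j \<Rightarrow> real"
  assumes "finite J" "card {j\<in>J. x j \<noteq> 0} \<le> q" "q \<ge> 1"
  shows "(\<Sum>j\<in>J. \<Sum>j'\<in>J - {j}. x j * x j') \<le> (1 - 1 / real q) * (\<Sum>j\<in>J. x j)\<^sup>2"
proof -
  define K where "K = {j\<in>J. x j \<noteq> 0}"
  have K: "K \<subseteq> J" "finite K" using assms(1) by (auto simp: K_def)
  have "(\<Sum>j\<in>J. x j) = (\<Sum>j\<in>K. x j)"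
    using assms(1) by (intro sum.mono_neutral_right) (auto simp: K_def)
  then have "(\<Sum>j\<in>J. x j)\<^sup>2 \<le> (\<Sum>j\<in>K. (x j)\<^sup>2) * card K"
    by (simp add: sum_squared_le_sum_of_squares)
  also have "\<dots> \<le> (\<Sum>j\<in>J. (x j)\<^sup>2) * real q"
    using K assms by (intro mult_mono sum_mono2 sum_nonneg) (auto simp: K_def)
  finally have "(\<Sum>j\<in>J. x j)\<^sup>2 / real q \<le> (\<Sum>j\<in>J. (x j)\<^sup>2)"
    using assms(3) by (simp add: field_simps)
  moreover have "(\<Sum>j\<in>J. \<Sum>j'\<in>J - {j}. x j * x j') = (\<Sum>j\<in>J. \<Sum>j'\<in>J. x j * x j') - (\<Sum>j\<in>J. (x j)\<^sup>2)"
    unfolding sum_subtractf[symmetric] using assms(1)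
    by (intro sum.cong) (auto simp: sum_diff1 power2_eq_square)
  ultimately show ?thesis
    by (simp add: left_diff_distrib power2_eq_square sum_product)
qed

section \<open>The rank bound for design matrices\<close>

text \<open>Scaling is available only for \<gamma> strictly above \<open>q / k\<close>, hence the
  free parameter. At \<open>\<gamma> = q / k\<close> the added term would be
  \<open>t * (q - 1) / k\<close>, a factor \<open>q\<close> below the one in the theorem, so
  strictness does no harm for \<open>q > 1\<close>.\<close>

lemma design_matrix_rank_scaled:
  fixes A :: "complex mat"
  assumes A: "A \<in> carrier_mat m n"
    and q: "q \<ge> 1" and k: "k \<ge> 1"
    and design: "design_matrix q k t A"
    and \<gamma>: "real q / real k < \<gamma>"
  shows "real n \<le> real (vec_space.rank m A) * (1 + real t * (1 - 1 / real q) * \<gamma>)"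
proof (cases "n = 0")
  case True
  then show ?thesis using q \<gamma>
    by (auto intro!: mult_nonneg_nonneg add_nonneg_nonneg order.trans[OF _ less_imp_le[OF \<gamma>]])
next
  case False
  define I where "I = {..<m}"
  define J where "J = {..<n}"
  have finIJ: "finite I" "finite J" by (simp_all add: I_def J_def)
  define R where "R = vec_space.rank m A"
  define C where "C j = {i\<in>I. A $$ (i, j) \<noteq> 0}" for j
  have finC: "finite (C j)" for j using finIJ by (simp add: C_def)
  have supp_col: "supp_vec (col A j) = C j" if "j \<in> J" for j
    using that A by (auto simp: supp_vec_def C_def I_def J_def)
  have supp_row: "supp_vec (row A i) = {j\<in>J. A $$ (i, j) \<noteq> 0}" if "i \<in> I" for i
    using that A by (auto simp: supp_vec_def I_def J_def)
  have rowq: "card {j\<in>J. A $$ (i, j) \<noteq> 0} \<le> q" if "i \<in> I" for i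
    using design A that supp_row[OF that] by (auto simp: design_matrix_def I_def)
  have colk: "card (C j) \<ge> k" if "j \<in> J" for j
    using design A that supp_col[OF that] by (auto simp: design_matrix_def J_def)
  have overlap: "card (C j \<inter> C j') \<le> t" if "j \<in> J" "j' \<in> J" "j \<noteq> j'" for j j'
  proof -
    have "card (supp_vec (col A j) \<inter> supp_vec (col A j')) \<le> t"
      using design A that unfolding design_matrix_def J_def by simp
    then show ?thesis using supp_col that by simp
  qed
  define a where "a i j = (cmod (A $$ (i, j)))\<^sup>2" for i j
  \<comment> \<open>The fractional scaling spreads mass 1 uniformly over each column support. A row
    meets at most \<open>q\<close> columns and gets at most \<open>1 / k\<close> from each, so
    \<beta> is \<open>q / k\<close>.\<close>
  define y where "y i j = (if i \<in> C j then 1 / real (card (C j)) else 0)" for i j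
  have ycol: "(\<Sum>i\<in>I. y i j) = 1" if "j \<in> J" for j
  proof -
    have "(\<Sum>i\<in>I. y i j) = (\<Sum>i\<in>C j. 1 / real (card (C j)))"
      unfolding y_def using finIJ by (intro sum.mono_neutral_cong_right) (auto simp: C_def)
    then show ?thesis using colk[OF that] k by simp
  qed
  have yrow: "(\<Sum>j\<in>J. y i j) \<le> real q / real k" if i: "i \<in> I" for i
  proof -
    have "(\<Sum>j\<in>J. y i j) = (\<Sum>j\<in>{j\<in>J. A $$ (i, j) \<noteq> 0}. 1 / real (card (C j)))"
      unfolding y_def using finIJ i by (intro sum.mono_neutral_cong_right) (auto simp: C_def)
    also have "\<dots> \<le> real (card {j\<in>J. A $$ (i, j) \<noteq> 0}) * (1 / real k)"
      using colk k by (intro sum_bounded_above) (auto intro!: frac_le)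
    also have "\<dots> \<le> real q / real k"
      using rowq[OF i] by (simp add: divide_right_mono)
    finally show ?thesis .
  qed
  obtain w where w: "\<And>i. i \<in> I \<Longrightarrow> w i > 0"
    and Dp: "\<And>j. j \<in> J \<Longrightarrow> (\<Sum>i\<in>I. w i * a i j) > 0"
    and rowsum: "\<And>i. i \<in> I \<Longrightarrow> (\<Sum>j\<in>J. w i * a i j / (\<Sum>i\<in>I. w i * a i j)) \<le> \<gamma>"
  proof (rule matrix_scaling[of I J a y "real q / real k" \<gamma>])
    show "a i j > 0" if "y i j > 0" for i j
      using that by (auto simp: y_def a_def C_def split: if_splits)
    show "0 < real q / real k" using q k by simp
  qed (use finIJ ycol yrow \<gamma> in \<open>auto simp: a_def y_def\<close>)
  define D where "D j = (\<Sum>i\<in>I. w i * a i j)" for j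
  \<comment> \<open>Row factors \<open>sqrt (w i)\<close> and column factors
    \<open>1 / sqrt (D j)\<close>, so that the squared moduli \<open>x\<close> form the scaled
    matrix.\<close>
  define b where "b j i = of_real (sqrt (w i / D j)) * A $$ (i, j)" for j i
  define x where "x i j = (cmod (b j i))\<^sup>2" for i j
  \<comment> \<open>Here \<open>G\<close> holds the squared moduli of the Gram entries, so its total
    is the squared Frobenius norm.\<close>
  define G where "G j j' = (cmod (\<Sum>i\<in>I. b j i * cnj (b j' i)))\<^sup>2" for j j'
  have x: "x i j = w i * a i j / D j" if "i \<in> I" "j \<in> J" for i j
    using w[OF that(1)] Dp[OF that(2)]
    by (simp add: x_def b_def norm_mult power_mult_distrib a_def D_def)
  have xcol: "(\<Sum>i\<in>I. x i j) = 1" if "j \<in> J" for j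
  proof -
    have "(\<Sum>i\<in>I. x i j) = (\<Sum>i\<in>I. w i * a i j / D j)"
      using x that by simp
    also have "\<dots> = D j / D j"
      by (simp only: D_def sum_divide_distrib)
    finally show ?thesis using Dp[OF that] by (simp add: D_def)
  qed
  have xrow: "(\<Sum>j\<in>J. x i j) \<le> \<gamma>" if "i \<in> I" for i
    using rowsum[OF that] x that by (simp add: D_def)
  have diag: "G j j = 1" if "j \<in> J" for j
  proof -
    have "(\<Sum>i\<in>I. b j i * cnj (b j i)) = of_real (\<Sum>i\<in>I. x i j)"
      unfolding x_def of_real_sum complex_norm_square ..
    then show ?thesis using xcol[OF that] by (simp add: G_def)
  qed
  have off: "G j j' \<le> real t * (\<Sum>i\<in>I. x i j * x i j')" if "j \<in> J" "j' \<in> J - {j}" for j j'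
    unfolding G_def x_def
  proof (rule norm_inner_sq_le_overlap[OF finIJ(1)])
    have "card {i\<in>I. b j i \<noteq> 0 \<and> b j' i \<noteq> 0} \<le> card (C j \<inter> C j')"
      using finC by (intro card_mono) (auto simp: b_def C_def)
    also have "\<dots> \<le> t" using overlap that by auto
    finally show "card {i\<in>I. b j i \<noteq> 0 \<and> b j' i \<noteq> 0} \<le> t" .
  qed
  \<comment> \<open>Only one factor of the squared row sum is replaced by \<gamma>; the other is
    kept because the row sums add up to \<open>n\<close>.\<close>
  have rowoff: "(\<Sum>j\<in>J. \<Sum>j'\<in>J - {j}. x i j * x i j') \<le> (1 - 1 / real q) * (\<gamma> * (\<Sum>j\<in>J. x i j))"
    if i: "i \<in> I" for i
  proof -
    have "card {j\<in>J. x i j \<noteq> 0} \<le> card {j\<in>J. A $$ (i, j) \<noteq> 0}"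
      using finIJ by (intro card_mono) (auto simp: x_def b_def)
    then have "(\<Sum>j\<in>J. \<Sum>j'\<in>J - {j}. x i j * x i j') \<le> (1 - 1 / real q) * (\<Sum>j\<in>J. x i j)\<^sup>2"
      using rowq[OF i] q finIJ by (intro sum_off_diagonal_le) auto
    also have "\<dots> \<le> (1 - 1 / real q) * (\<gamma> * (\<Sum>j\<in>J. x i j))"
      unfolding power2_eq_square using xrow[OF i] q
      by (intro mult_left_mono mult_right_mono sum_nonneg) (auto simp: x_def)
    finally show ?thesis .
  qed
  have total: "(\<Sum>i\<in>I. \<Sum>j\<in>J. x i j) = real n"
  proof -
    have "(\<Sum>i\<in>I. \<Sum>j\<in>J. x i j) = (\<Sum>j\<in>J. \<Sum>i\<in>I. x i j)" by (rule sum.swap)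
    then show ?thesis using xcol by (simp add: J_def)
  qed
  have "(\<Sum>j\<in>J. \<Sum>j'\<in>J. G j j') = (\<Sum>j\<in>J. G j j + (\<Sum>j'\<in>J - {j}. G j j'))"
    using finIJ by (intro sum.cong) (auto simp: sum.remove)
  also have "\<dots> = real n + (\<Sum>j\<in>J. \<Sum>j'\<in>J - {j}. G j j')"
    using diag by (simp add: sum.distrib J_def)
  also have "(\<Sum>j\<in>J. \<Sum>j'\<in>J - {j}. G j j') \<le> (\<Sum>j\<in>J. \<Sum>j'\<in>J - {j}. real t * (\<Sum>i\<in>I. x i j * x i j'))"
    using off by (intro sum_mono) blast
  also have "\<dots> = real t * (\<Sum>j\<in>J. \<Sum>j'\<in>J - {j}. \<Sum>i\<in>I. x i j * x i j')"
    by (simp add: sum_distrib_left)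
  \<comment> \<open>Exchanging sums groups the overlaps by row, where \<open>rowoff\<close>
    applies.\<close>
  also have "(\<Sum>j\<in>J. \<Sum>j'\<in>J - {j}. \<Sum>i\<in>I. x i j * x i j')
      = (\<Sum>j\<in>J. \<Sum>i\<in>I. \<Sum>j'\<in>J - {j}. x i j * x i j')"
    by (rule sum.cong[OF refl], rule sum.swap)
  also have "\<dots> = (\<Sum>i\<in>I. \<Sum>j\<in>J. \<Sum>j'\<in>J - {j}. x i j * x i j')"
    by (rule sum.swap)
  also have "real t * \<dots> \<le> real t * (\<Sum>i\<in>I. (1 - 1 / real q) * (\<gamma> * (\<Sum>j\<in>J. x i j)))"
    using rowoff by (intro mult_left_mono sum_mono) auto
  also have "\<dots> = real t * (1 - 1 / real q) * \<gamma> * real n"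
    unfolding total[symmetric] by (simp add: sum_distrib_left mult.assoc)
  finally have frob: "(\<Sum>j\<in>J. \<Sum>j'\<in>J. G j j') \<le> real n * (1 + real t * (1 - 1 / real q) * \<gamma>)"
    by (simp add: algebra_simps)
  interpret vec_space "TYPE(complex)" m .
  obtain S c where S: "finite S" "card S = R"
    and fac: "\<And>i j. i < m \<Longrightarrow> j < n \<Longrightarrow> A $$ (i, j) = (\<Sum>v\<in>S. c j v * v $ i)"
    using rank_factorization[OF A] unfolding R_def by blast
  \<comment> \<open>The scaling factors are absorbed into the two sides of the factorisation, so
    \<open>b\<close> still needs only \<open>R\<close> terms.\<close>
  have "b j i = (\<Sum>v\<in>S. (c j v / of_real (sqrt (D j))) * (of_real (sqrt (w i)) * v $ i))"
    if "j \<in> J" "i \<in> I" for j i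
  proof -
    have "b j i = of_real (sqrt (w i)) / of_real (sqrt (D j)) * (\<Sum>v\<in>S. c j v * v $ i)"
      using fac[of i j] that by (simp add: b_def real_sqrt_divide I_def J_def)
    then show ?thesis by (simp add: sum_distrib_left mult_ac)
  qed
  then have "(\<Sum>j\<in>J. \<Sum>i\<in>I. (cmod (b j i))\<^sup>2)\<^sup>2 \<le> real (card S) * (\<Sum>j\<in>J. \<Sum>j'\<in>J. G j j')"
    unfolding G_def by (rule gram_trace_le[OF S(1) finIJ])
  moreover have "(\<Sum>j\<in>J. \<Sum>i\<in>I. (cmod (b j i))\<^sup>2) = real n"
    using xcol by (simp add: x_def J_def)
  ultimately have "(real n)\<^sup>2 \<le> real R * (\<Sum>j\<in>J. \<Sum>j'\<in>J. G j j')"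
    using S(2) by simp
  also have "\<dots> \<le> real R * (real n * (1 + real t * (1 - 1 / real q) * \<gamma>))"
    using frob by (intro mult_left_mono) auto
  finally have "real n * real n \<le> real n * (real R * (1 + real t * (1 - 1 / real q) * \<gamma>))"
    by (simp add: power2_eq_square mult_ac)
  then show ?thesis using False by (simp add: R_def)
qed

theorem corollary1p4:
  fixes A :: "complex mat" and m n q k t :: nat
  assumes "A \<in> carrier_mat m n"
    and "q \<ge> 1" and "k \<ge> 1"
    and "design_matrix q k t A"
  shows "real (vec_space.rank m A)
           \<ge> real n / (1 + real q * (real q - 1) * real t / real k)
       \<and> real n / (1 + real q * (real q - 1) * real t / real k)
           \<ge> real n - real n * real t * real q * (real q - 1) / real k"
proof -
  define z where "z = real q * (real q - 1) * real t / real k"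
  have z: "z \<ge> 0" using assms(2) by (simp add: z_def)
  \<comment> \<open>Any \<open>\<gamma>\<close> above \<open>q / k\<close> works when \<open>q = 1\<close>, because the off-diagonal terms vanish then.\<close>
  define \<gamma> where "\<gamma> = (if q = 1 then 2 else (real q)\<^sup>2) / real k"
  have "real q < (real q)\<^sup>2" if "q \<noteq> 1"
    using that assms(2) by (simp add: power2_eq_square)
  then have "real q / real k < \<gamma>"
    using assms(3) by (auto simp: \<gamma>_def intro: divide_strict_right_mono)
  then have "real n \<le> real (vec_space.rank m A) * (1 + real t * (1 - 1 / real q) * \<gamma>)"
    by (rule design_matrix_rank_scaled[OF assms])
  \<comment> \<open>For \<open>q > 1\<close> this is \<open>(1 - 1 / q) * q^2 = q * (q - 1)\<close>;
    for \<open>q = 1\<close> both sides vanish.\<close>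
  moreover have "real t * (1 - 1 / real q) * \<gamma> = z"
    using assms(2,3) by (simp add: \<gamma>_def z_def field_simps power2_eq_square)
  ultimately have "real n \<le> real (vec_space.rank m A) * (1 + z)" by simp
  then have 1: "real n / (1 + z) \<le> real (vec_space.rank m A)"
    using z by (simp add: pos_divide_le_eq)
  \<comment> \<open>The second inequality of the theorem is \<open>1 - z^2 <= 1\<close> divided by
    \<open>1 + z\<close> and multiplied by \<open>n\<close>.\<close>
  have "(1 - z) * (1 + z) \<le> 1" using z by (simp add: algebra_simps)
  then have "real n * ((1 - z) * (1 + z)) \<le> real n * 1"
    by (intro mult_left_mono) auto
  then have "real n * (1 - z) \<le> real n / (1 + z)"
    using z by (simp add: pos_le_divide_eq mult.assoc)
  moreover have "real n * (1 - z) = real n - real n * real t * real q * (real q - 1) / real k"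
    by (simp add: z_def algebra_simps)
  ultimately show ?thesis using 1 unfolding z_def by simp
qed

end
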